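(* Let $G\in\mathscr{B}$ with $\operatorname{diam}(G)\ge 4$. Then the eccentricity matrix $E(G)$ is irreducible.
   Context: All graphs are finite, simple and connected; $d(u,v)$ is the distance in $G$, $e(u)=\max_v d(u,v)$, $\operatorname{diam}(G)=\max_u e(u)$. The eccentricity matrix $E(G)$ (vertices $v_1,\dots,v_n$) is the $n\times n$ matrix with $(i,j)$ entry $d(v_i,v_j)$ if $d(v_i,v_j)=\min\{e(v_i),e(v_j)\}$ and $0$ otherwise. A square matrix $M$ is irreducible if there is no permutation matrix $P$ such that $PMP^{T}$ is block upper triangular with at least two nonempty diagonal blocks; for a nonnegative symmetric matrix this is equivalent to the graph on the index set with an edge $\{i,j\}$ whenever $m_{ij}\neq0$ being connected. A block is a maximal connected subgraph without a cut-vertex. A bi-block graph is a connected graph all of whose blocks are complete bipartite graphs. $\mathscr{B}$ is the class of bi-block graphs with at least two blocks in which every block contains at most two cut-vertices of $G$. *)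

theory Defs
  imports
    "Jordan_Normal_Form.Matrix"
    "HOL-Combinatorics.Permutations"
    "Graph_Theory.Graph_Theory"
begin

section \<open>Distances and the eccentricity matrix\<close>

text \<open>
  Finite simple graphs are modelled by the locale \<^locale>\<open>graph\<close>: finite, symmetric digraphs
  without loops and parallel arcs.
\<close>

text \<open>Only meaningful if \<open>v\<close> is reachable from \<open>u\<close>: the infimum of the empty set is 0.\<close>

definition gdist :: "('a, 'b) pre_digraph \<Rightarrow> 'a \<Rightarrow> 'a \<Rightarrow> nat" where
  "gdist G u v = Inf {length p | p. pre_digraph.awalk G u p v}"

definition eccentricity :: "('a, 'b) pre_digraph \<Rightarrow> 'a \<Rightarrow> nat" where
  "eccentricity G u = Max (gdist G u ` verts G)"

definition diam :: "('a, 'b) pre_digraph \<Rightarrow> nat" where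
  "diam G = Max (eccentricity G ` verts G)"

text \<open>The list \<open>vs\<close> is the enumeration of the vertices that indexes the rows and columns.\<close>

definition eccentricity_mat :: "('a, 'b) pre_digraph \<Rightarrow> 'a list \<Rightarrow> real mat" where
  "eccentricity_mat G vs = mat (length vs) (length vs) (\<lambda>(i, j).
     if gdist G (vs ! i) (vs ! j) = min (eccentricity G (vs ! i)) (eccentricity G (vs ! j))
     then real (gdist G (vs ! i) (vs ! j)) else 0)"

text \<open>On reachable vertices, \<open>gdist\<close> is the shortest-path cost of the library for unit costs.\<close>

lemma (in wf_digraph) gdist_eq_mu:
  assumes "u \<rightarrow>\<^sup>* v"
  shows "ereal (real (gdist G u v)) = \<mu> (\<lambda>_. 1) u v"
proof -
  have cost: "awalk_cost (\<lambda>_. 1) p = real (length p)" for p :: "'b list"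
    by (induction p) (auto simp: awalk_cost_def)
  let ?S = "{length p | p. awalk u p v}"
  have "?S \<noteq> {}" using assms by (auto simp: reachable_awalk)
  then have "gdist G u v \<in> ?S" unfolding gdist_def by (rule Inf_nat_def1)
  then obtain p where p: "awalk u p v" "length p = gdist G u v" by auto
  have min: "gdist G u v \<le> length q" if "awalk u q v" for q
    unfolding gdist_def using that by (intro cInf_lower) auto
  show ?thesis unfolding \<mu>_def cost
  proof (rule antisym)
    show "ereal (real (gdist G u v)) \<le> (INF p\<in>{p. awalk u p v}. ereal (real (length p)))"
      using min by (intro INF_greatest) auto
    show "(INF p\<in>{p. awalk u p v}. ereal (real (length p))) \<le> ereal (real (gdist G u v))"
      using p by (intro INF_lower2[of p]) auto
  qed
qed


section \<open>Irreducible matrices\<close>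

definition permutation_mat :: "nat \<Rightarrow> 'a :: semiring_1 mat \<Rightarrow> bool" where
  "permutation_mat n P \<longleftrightarrow>
     (\<exists>p. p permutes {..<n} \<and> P = mat n n (\<lambda>(i, j). if j = p i then 1 else 0))"

text \<open>
  The list \<open>ns\<close> contains the sizes of the diagonal blocks; the partial sums
  \<open>sum_list (take r ns)\<close> are the positions of the block boundaries.
\<close>

definition block_upper_triangular :: "nat list \<Rightarrow> 'a :: zero mat \<Rightarrow> bool" where
  "block_upper_triangular ns M \<longleftrightarrow>
     M \<in> carrier_mat (sum_list ns) (sum_list ns) \<and>
     (\<forall>r \<le> length ns. \<forall>i < sum_list ns. \<forall>j < sum_list ns.
        j < sum_list (take r ns) \<and> sum_list (take r ns) \<le> i \<longrightarrow> M $$ (i, j) = 0)"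

definition irreducible_mat :: "'a :: semiring_1 mat \<Rightarrow> bool" where
  "irreducible_mat M \<longleftrightarrow> square_mat M \<and>
     \<not> (\<exists>P ns. permutation_mat (dim_row M) P \<and> length ns \<ge> 2 \<and> (\<forall>n \<in> set ns. n > 0) \<and>
               block_upper_triangular ns (P * M * P\<^sup>T))"


section \<open>Blocks and bi-block graphs\<close>

text \<open>
  Cut-vertices of a connected graph.  The first conjunct on \<open>del_vert\<close> is needed because
  \<^const>\<open>Digraph_Component.connected\<close> fails for the graph without vertices; thus the vertex of
  \<open>K\<^sub>1\<close> is not a cut-vertex.
\<close>

definition cut_vertex :: "('a, 'b) pre_digraph \<Rightarrow> 'a \<Rightarrow> bool" where
  "cut_vertex G v \<longleftrightarrow> v \<in> verts G \<and> verts (pre_digraph.del_vert G v) \<noteq> {} \<and>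
     \<not> Digraph_Component.connected (pre_digraph.del_vert G v)"

text \<open>
  The condition \<open>graph B\<close> restricts the subdigraphs of the library to subgraphs in the undirected
  sense, i.e. to those that contain both or none of the two arcs representing an edge.
\<close>

definition is_block :: "('a, 'b) pre_digraph \<Rightarrow> ('a, 'b) pre_digraph \<Rightarrow> bool" where
  "is_block G = pre_digraph.max_subgraph G
     (\<lambda>B. graph B \<and> Digraph_Component.connected B \<and> (\<forall>v. \<not> cut_vertex B v))"

definition bi_block_graph :: "('a, 'b) pre_digraph \<Rightarrow> bool" where
  "bi_block_graph G \<longleftrightarrow> graph G \<and> Digraph_Component.connected G \<and>
     (\<forall>B. is_block G B \<longrightarrow> (\<exists>m > 0. \<exists>n > 0. complete_bipartite_digraph m n B))"

definition bi_block_class :: "('a, 'b) pre_digraph set" (\<open>\<B>\<close>) where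
  "\<B> = {G. bi_block_graph G \<and> card {B. is_block G B} \<ge> 2 \<and>
            (\<forall>B. is_block G B \<longrightarrow> card {v \<in> verts B. cut_vertex G v} \<le> 2)}"

end

theory Submission
  imports Defs
begin

text \<open>
  Let \<open>x\<close>, \<open>y\<close> be a diametral pair and \<open>S\<close> the block containing the middle edge of a geodesic
  between them.  Every vertex \<open>v\<close> enters \<open>S\<close> through a unique gate, distances between vertices
  with different gates add up along the gates, and the gate of \<open>v\<close> is a cut-vertex unless
  \<open>v\<close> lies in \<open>S\<close>.  Since \<open>S\<close> is complete bipartite, it has diameter at most 2; together with
  the bound on its cut-vertices this forces the eccentricity of every vertex \<open>u\<close> to be attained
  at \<open>x\<close> or at \<open>y\<close>.  Hence in the graph of nonzero entries of the eccentricity matrix every vertex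
  is adjacent to \<open>x\<close> or \<open>y\<close>, and \<open>x\<close> is adjacent to \<open>y\<close>, so that this graph is connected.
\<close>

section \<open>Blocks of a symmetric relation\<close>

definition connected_on :: "'a rel \<Rightarrow> 'a set \<Rightarrow> bool" where
  "connected_on E S \<longleftrightarrow> (\<forall>u\<in>S. \<forall>v\<in>S. (u, v) \<in> (Restr E S)\<^sup>*)"

definition biconnected_on :: "'a rel \<Rightarrow> 'a set \<Rightarrow> bool" where
  "biconnected_on E S \<longleftrightarrow> connected_on E S \<and> (\<forall>t. connected_on E (S - {t}))"

definition block_on :: "'a set \<Rightarrow> 'a rel \<Rightarrow> 'a set \<Rightarrow> bool" where
  "block_on V E S \<longleftrightarrow> S \<subseteq> V \<and> biconnected_on E S \<and>
     (\<forall>T. S \<subseteq> T \<and> T \<subseteq> V \<and> biconnected_on E T \<longrightarrow> T = S)"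

section \<open>Distance in a relation\<close>

definition rel_dist :: "'a rel \<Rightarrow> 'a \<Rightarrow> 'a \<Rightarrow> nat" where
  "rel_dist E u v = (LEAST n. (u, v) \<in> E ^^ n)"

lemma rel_dist_le: "(u, v) \<in> E ^^ n \<Longrightarrow> rel_dist E u v \<le> n"
  unfolding rel_dist_def by (rule Least_le)

lemma rel_dist_path:
  assumes "(u, v) \<in> E\<^sup>*"
  shows "(u, v) \<in> E ^^ rel_dist E u v"
  unfolding rel_dist_def by (rule LeastI_ex) (use assms rtrancl_imp_relpow in blast)

lemma rel_dist_self [simp]: "rel_dist E u u = 0"
  using rel_dist_le[of u u 0 E] by simp

lemma sym_relpow:
  assumes "sym E" "(u, v) \<in> E ^^ n"
  shows "(v, u) \<in> E ^^ n"
  using assms(2)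
proof (induction n arbitrary: v)
  case (Suc n)
  then obtain w where "(u, w) \<in> E ^^ n" "(w, v) \<in> E" by auto
  with Suc.IH assms(1) have "(w, u) \<in> E ^^ n" "(v, w) \<in> E" by (auto dest: symD)
  then show ?case by (rule relpow_Suc_I2[rotated])
qed simp

lemma rel_dist_commute: "sym E \<Longrightarrow> rel_dist E u v = rel_dist E v u"
  unfolding rel_dist_def by (metis sym_relpow)

lemma connected_on_mono: "connected_on E S \<Longrightarrow> E \<subseteq> E' \<Longrightarrow> connected_on E' S"
  unfolding connected_on_def using rtrancl_mono[of "Restr E S" "Restr E' S"] by blast

text \<open>An ear attached to a biconnected set: deleting a vertex of the ear leaves two pieces,
  each still hanging on one of the two end points.\<close>

lemma biconnected_on_ear:
  fixes f :: "nat \<Rightarrow> 'a"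
  assumes "sym E" and S: "biconnected_on E S"
    and ends: "f 0 \<in> S" "f n \<in> S"
    and steps: "\<And>i. i < n \<Longrightarrow> (f i, f (Suc i)) \<in> E"
    and inj: "inj_on f {..n}"
  shows "biconnected_on E (S \<union> f ` {..n})"
proof -
  let ?T = "S \<union> f ` {..n}"
  \<comment> \<open>\<open>Z\<close> stands for \<open>{}\<close> or a single deleted vertex, so one
    argument yields both conjuncts of \<open>biconnected_on\<close>.\<close>
  have conn: "connected_on E (?T - Z)"
    if SZ: "connected_on E (S - Z)" and Z: "\<And>a b. a \<in> Z \<Longrightarrow> b \<in> Z \<Longrightarrow> a = b" for Z
  proof -
    let ?R = "Restr E (?T - Z)"
    have "sym ?R" using \<open>sym E\<close> by (auto simp: sym_def)
    then have sym': "(a, b) \<in> ?R\<^sup>* \<Longrightarrow> (b, a) \<in> ?R\<^sup>*" for a b by (metis sym_rtrancl symD)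
    have inS: "(a, b) \<in> ?R\<^sup>*" if "a \<in> S - Z" "b \<in> S - Z" for a b
      using SZ that rtrancl_mono[of "Restr E (S - Z)" ?R] unfolding connected_on_def by blast
    have reach: "\<exists>s\<in>S - Z. (u, s) \<in> ?R\<^sup>*" if "u \<in> ?T - Z" for u
    proof (cases "u \<in> S")
      case False
      with that obtain i where i: "i \<le> n" "u = f i" "f i \<notin> Z" by auto
      have path: "(f a, f b) \<in> ?R\<^sup>*" if "a \<le> b" "b \<le> n" "\<And>j. a \<le> j \<Longrightarrow> j \<le> b \<Longrightarrow> f j \<notin> Z" for a b
        using that
      proof (induction b rule: dec_induct)
        case (step m)
        then have "(f a, f m) \<in> ?R\<^sup>*" by simp
        moreover have "(f m, f (Suc m)) \<in> ?R"
          using step steps[of m] by auto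
        ultimately show ?case by (rule rtrancl_into_rtrancl)
      qed simp
      \<comment> \<open>A deleted vertex occurs at most once on the ear, so it spares the stretch
        from \<open>f i\<close> back to \<open>f 0\<close> or the one forward to
        \<open>f n\<close>.\<close>
      show ?thesis
      proof (cases "\<forall>j\<le>i. f j \<notin> Z")
        case True
        then have "(f 0, f i) \<in> ?R\<^sup>*" using i path[of 0 i] by simp
        then show ?thesis using sym' ends(1) True i by blast
      next
        case False
        then obtain j where j: "j \<le> i" "f j \<in> Z" by auto
        have *: "f k \<notin> Z" if "i \<le> k" "k \<le> n" for k
        proof
          assume "f k \<in> Z"
          then have "f j = f k" using Z j by blast
          then have "j = k" using inj that j i by (auto simp: inj_on_def)
          then show False using that j i by simp
        qed
        then have "(f i, f n) \<in> ?R\<^sup>*" using i path[of i n] by simp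
        then show ?thesis using ends(2) * i by blast
      qed
    qed (use that in blast)
    show ?thesis unfolding connected_on_def
    proof (intro ballI)
      fix u v assume "u \<in> ?T - Z" "v \<in> ?T - Z"
      then obtain s t where "s \<in> S - Z" "(u, s) \<in> ?R\<^sup>*" "t \<in> S - Z" "(v, t) \<in> ?R\<^sup>*"
        using reach by blast
      then show "(u, v) \<in> ?R\<^sup>*" using sym' inS[of s t] by (meson rtrancl_trans)
    qed
  qed
  show ?thesis
    using conn[of "{}"] conn[of "{_}"] S by (auto simp: biconnected_on_def)
qed

section \<open>Finite connected symmetric relations and their metric\<close>

locale connected_relation =
  fixes V :: "'a set" and E :: "'a rel"
  assumes finite_V: "finite V"
    and E_sub: "E \<subseteq> V \<times> V"
    and sym_E: "sym E"
    and connected: "u \<in> V \<Longrightarrow> v \<in> V \<Longrightarrow> (u, v) \<in> E\<^sup>*"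
begin

abbreviation d :: "'a \<Rightarrow> 'a \<Rightarrow> nat" where "d \<equiv> rel_dist E"

lemma d_path: "u \<in> V \<Longrightarrow> v \<in> V \<Longrightarrow> (u, v) \<in> E ^^ d u v"
  using connected by (rule rel_dist_path)

lemma d_triangle:
  assumes "u \<in> V" "v \<in> V" "w \<in> V"
  shows "d u w \<le> d u v + d v w"
proof (rule rel_dist_le)
  show "(u, w) \<in> E ^^ (d u v + d v w)"
    using d_path[of u v] d_path[of v w] assms by (auto simp: relpow_add)
qed

lemma d_edge: "(u, v) \<in> E \<Longrightarrow> d u v \<le> 1"
  using rel_dist_le[of u v 1 E] by simp

lemma d_commute: "d u v = d v u"
  using rel_dist_commute sym_E by metis

lemma d_eq_0: "u \<in> V \<Longrightarrow> v \<in> V \<Longrightarrow> d u v = 0 \<longleftrightarrow> u = v"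
  using d_path[of u v] by auto

text \<open>A geodesic is split after \<open>k\<close> steps; with \<open>k\<close> half the
  distance this supplies the middle edge that determines the block \<open>S\<close>.\<close>

lemma edge_on_geodesic:
  assumes "x \<in> V" "y \<in> V" "k < d x y"
  obtains p q where "(p, q) \<in> E" "d x p \<le> k" "d q y \<le> d x y - Suc k"
proof -
  have "(x, y) \<in> E ^^ (k + Suc (d x y - Suc k))" using d_path assms by simp
  then obtain p where p: "(x, p) \<in> E ^^ k" "(p, y) \<in> E ^^ Suc (d x y - Suc k)"
    unfolding relpow_add by blast
  from relpow_Suc_D2[OF p(2)] obtain q where "(p, q) \<in> E" "(q, y) \<in> E ^^ (d x y - Suc k)" by auto
  with p(1) that show thesis by (auto intro: rel_dist_le)
qed

text \<open>The vertex at which a walk from \<open>v\<close> enters \<open>S\<close>; by maximality of a block it is unique.\<close>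

definition gate :: "'a set \<Rightarrow> 'a \<Rightarrow> 'a \<Rightarrow> bool" where
  "gate S v g \<longleftrightarrow> g \<in> S \<and> (v, g) \<in> (E - S \<times> S)\<^sup>*"

section \<open>Gates of a block\<close>

lemma gate_self: "s \<in> S \<Longrightarrow> gate S s s"
  by (simp add: gate_def)

lemma gate_step: "(u, v) \<in> E \<Longrightarrow> u \<notin> S \<or> v \<notin> S \<Longrightarrow> gate S v g \<Longrightarrow> gate S u g"
  unfolding gate_def using converse_rtrancl_into_rtrancl[of u v "E - S \<times> S" g] by blast

lemma gate_exists:
  assumes "v \<in> V" "S \<subseteq> V" "S \<noteq> {}"
  shows "\<exists>g. gate S v g"
proof -
  obtain s where s: "s \<in> S" using assms(3) by auto
  then have "(v, s) \<in> E\<^sup>*" using assms connected by auto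
  then show ?thesis
  proof (induction rule: converse_rtrancl_induct)
    case base
    then show ?case using s gate_self by blast
  next
    \<comment> \<open>If \<open>u\<close> lies in \<open>S\<close> it is its own gate; otherwise it
      inherits the gate of \<open>w\<close>.\<close>
    case (step u w)
    then show ?case using gate_self gate_step by metis
  qed
qed

text \<open>Otherwise the walk yields an ear, and adding it to \<open>S\<close> preserves
  biconnectedness. Maximality puts the ear inside \<open>S\<close>, but its first edge starts in
  \<open>S\<close> and is not an edge inside \<open>S\<close>.\<close>

lemma block_ear_trivial:
  assumes "block_on V E S" "g \<in> S" "b \<in> S" "(g, b) \<in> (E - S \<times> S)\<^sup>*"
  shows "g = b"
proof (rule ccontr)
  assume "g \<noteq> b"
  let ?F = "E - S \<times> S"
  \<comment> \<open>A shortest walk is chosen: a repeated vertex could be cut out, which gives the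
    injectivity required of an ear.\<close>
  define n where "n = rel_dist ?F g b"
  have "(g, b) \<in> ?F ^^ n"
    unfolding n_def using assms(4) by (rule rel_dist_path)
  then obtain f where f: "f 0 = g" "f n = b" "\<And>i. i < n \<Longrightarrow> (f i, f (Suc i)) \<in> ?F"
    unfolding relpow_fun_conv by auto
  have path: "(f i, f (i + k)) \<in> ?F ^^ k" if "i + k \<le> n" for i k
    unfolding relpow_fun_conv using f(3) that by (intro exI[of _ "\<lambda>j. f (i + j)"]) auto
  have neq: "f i \<noteq> f j" if "i < j" "j \<le> n" for i j
  proof
    assume eq: "f i = f j"
    have "(g, f i) \<in> ?F ^^ i" "(f j, b) \<in> ?F ^^ (n - j)"
      using path[of 0 i] path[of j "n - j"] f that by auto
    then have "(g, b) \<in> ?F ^^ (i + (n - j))" using eq by (auto simp: relpow_add)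
    then have "n \<le> i + (n - j)" unfolding n_def by (rule rel_dist_le)
    then show False using that by simp
  qed
  have inj: "inj_on f {..n}"
    by (rule inj_onI) (metis atMost_iff linorder_less_linear neq)
  have "n > 0" using f \<open>g \<noteq> b\<close> by (cases n) auto
  have "biconnected_on E (S \<union> f ` {..n})"
    using assms f inj sym_E by (intro biconnected_on_ear) (auto simp: block_on_def)
  moreover have "f ` {..n} \<subseteq> V"
  proof
    fix v assume "v \<in> f ` {..n}"
    then obtain i where "i \<le> n" "v = f i" by auto
    then show "v \<in> V"
      using f(2) f(3)[of i] E_sub assms(1,3) by (cases "i = n") (auto simp: block_on_def)
  qed
  ultimately have "S \<union> f ` {..n} = S"
    using assms(1) unfolding block_on_def by blast
  then have "f 1 \<in> S" using \<open>n > 0\<close> by auto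
  then show False using f(3)[of 0] \<open>n > 0\<close> f(1) assms(2) by simp
qed

text \<open>The reversed walk to \<open>g\<close> followed by the walk to \<open>h\<close> joins two
  vertices of \<open>S\<close> without using an edge inside \<open>S\<close>.\<close>

lemma gate_unique:
  assumes "block_on V E S" "gate S v g" "gate S v h"
  shows "g = h"
proof -
  have "sym (E - S \<times> S)" using sym_E by (auto simp: sym_def)
  then have "(g, v) \<in> (E - S \<times> S)\<^sup>*"
    using assms(2) unfolding gate_def by (metis sym_rtrancl symD)
  then have "(g, h) \<in> (E - S \<times> S)\<^sup>*" using assms(3) unfolding gate_def by auto
  then show ?thesis using block_ear_trivial assms unfolding gate_def by blast
qed

text \<open>The bound concerns walks of any length, not just geodesics, so that induction can remove
  the first edge. An edge inside \<open>S\<close> moves the gate from \<open>v\<close> to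
  \<open>u\<close>; any other edge leaves the gate unchanged.\<close>

lemma walk_through_gates:
  assumes S: "block_on V E S" and "v \<in> V" "w \<in> V"
    and "(v, w) \<in> E ^^ n" "gate S v g" "gate S w h"
  shows "g = h \<or> d v g + d g h + d h w \<le> n"
  using assms(2,4,5)
proof (induction n arbitrary: v g)
  case 0
  then show ?case using gate_unique[OF S] assms(6) by auto
next
  case (Suc n)
  from relpow_Suc_D2[OF Suc.prems(2)] obtain u where u: "(v, u) \<in> E" "(u, w) \<in> E ^^ n" by auto
  have V: "u \<in> V" "h \<in> V" "g \<in> V"
    using u E_sub S assms(6) Suc.prems unfolding gate_def block_on_def by auto
  show ?case
  proof (cases "v \<in> S \<and> u \<in> S")
    case True
    then have g: "g = v" using gate_unique[OF S] gate_self Suc.prems(3) by blast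
    from Suc.IH[OF V(1) u(2) gate_self[of u S]] True
    have "u = h \<or> d u h + d h w \<le> n" by auto
    moreover have "d v h \<le> 1 + d u h"
      using d_triangle[of v u h] d_edge[OF u(1)] V Suc.prems by simp
    ultimately show ?thesis
      using g rel_dist_le[OF u(2)] d_edge[OF u(1)] by auto
  next
    case False
    have "(u, v) \<in> E" using u sym_E by (auto dest: symD)
    then have "gate S u g" using gate_step[of u v S g] False Suc.prems by blast
    from Suc.IH[OF V(1) u(2) this] show ?thesis
      using d_triangle[of v u g] d_edge[OF u(1)] V Suc.prems by auto
  qed
qed

lemma d_gates:
  assumes "block_on V E S" "v \<in> V" "w \<in> V" "gate S v g" "gate S w h" "g \<noteq> h"
  shows "d v w = d v g + d g h + d h w"
proof (rule antisym)
  have "g \<in> V" "h \<in> V" using assms unfolding gate_def block_on_def by auto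
  then show "d v w \<le> d v g + d g h + d h w"
    using d_triangle[of v g w] d_triangle[of g h w] assms by simp
  show "d v g + d g h + d h w \<le> d v w"
    using walk_through_gates[OF assms(1-3) d_path assms(4,5)] assms by auto
qed

lemma d_gate:
  assumes "block_on V E S" "v \<in> V" "gate S v g" "s \<in> S"
  shows "d v s = d v g + d g s"
proof (cases "g = s")
  case False
  moreover have "s \<in> V" using assms by (auto simp: block_on_def)
  ultimately show ?thesis using d_gates[of S v s g s] assms gate_self by simp
qed simp

text \<open>A walk from \<open>v\<close> to \<open>b\<close> avoiding \<open>g\<close> would carry a
  gate other than \<open>g\<close> back to \<open>v\<close>, because each of its vertices in
  \<open>S\<close> is its own gate.\<close>

lemma gate_is_cut:
  assumes "block_on V E S" "v \<in> V" "v \<notin> S" "gate S v g" "b \<in> S" "b \<noteq> g"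
  shows "\<not> connected_on E (V - {g})"
proof
  assume "connected_on E (V - {g})"
  moreover have "v \<in> V - {g}" "b \<in> V - {g}"
    using assms unfolding gate_def block_on_def by auto
  ultimately have "(v, b) \<in> (Restr E (V - {g}))\<^sup>*" unfolding connected_on_def by blast
  then have "\<exists>h. gate S v h \<and> h \<noteq> g"
  proof (induction rule: converse_rtrancl_induct)
    case base
    then show ?case using assms gate_self by blast
  next
    case (step u w)
    then show ?case using gate_step gate_self by (metis DiffD2 Int_iff SigmaD1 insertI1)
  qed
  then show False using gate_unique assms by blast
qed

end

section \<open>The eccentricity is attained at a diametral pair\<close>

context connected_relation
begin

text \<open>The block is the one containing the middle edge of a geodesic from \<open>x\<close> to \<open>y\<close>.  Either both
  end points hang on distinct gates of it, which are then its only cut-vertices, or the diameter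
  is 4 and the gate of \<open>x\<close> is a central vertex.\<close>

lemma farthest_from_diametral_pair:
  assumes diam: "\<And>u v. u \<in> V \<Longrightarrow> v \<in> V \<Longrightarrow> d u v \<le> d x y" "4 \<le> d x y"
    and xy: "x \<in> V" "y \<in> V"
    and blocks: "\<And>p q. (p, q) \<in> E \<Longrightarrow> \<exists>S. block_on V E S \<and> p \<in> S \<and> q \<in> S \<and>
        (\<forall>a\<in>S. \<forall>b\<in>S. d a b \<le> 2) \<and> card {v \<in> S. \<not> connected_on E (V - {v})} \<le> 2"
    and uw: "u \<in> V" "w \<in> V"
  shows "d u w \<le> max (d u x) (d u y)"
proof -
  \<comment> \<open>Half the distance rounded down. The edge leaves at most \<open>k\<close> steps
    towards \<open>x\<close> and at most \<open>d x y - k - 1\<close> towards \<open>y\<close>, so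
    only \<open>y\<close> can turn out to be its own gate.\<close>
  define k where "k = d x y div 2"
  have "k < d x y" using diam(2) unfolding k_def by simp
  then obtain p q where pq: "(p, q) \<in> E" "d x p \<le> k" "d q y \<le> d x y - Suc k"
    using edge_on_geodesic xy by blast
  from blocks[OF pq(1)] obtain S where S: "block_on V E S" and pqS: "p \<in> S" "q \<in> S"
    and d2: "\<And>a b. a \<in> S \<Longrightarrow> b \<in> S \<Longrightarrow> d a b \<le> 2"
    and cut: "card {v \<in> S. \<not> connected_on E (V - {v})} \<le> 2" by blast
  have SV: "s \<in> V" if "s \<in> S" for s using S that by (auto simp: block_on_def)
  have "\<forall>v\<in>V. \<exists>g. gate S v g" using gate_exists SV pqS by blast
  then obtain g where g: "\<And>v. v \<in> V \<Longrightarrow> gate S v (g v)" by metis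
  have gS: "g v \<in> S" "g v \<in> V" if "v \<in> V" for v
    using g[OF that] SV unfolding gate_def by auto
  have g_self: "g s = s" if "s \<in> S" for s
    using gate_unique[OF S g gate_self] that SV by blast
  have dS: "d v s = d v (g v) + d (g v) s" if "v \<in> V" "s \<in> S" for v s
    using d_gate[OF S that(1) g that(2)] that by blast
  have dd: "d a b = d a (g a) + d (g a) (g b) + d (g b) b"
    if "a \<in> V" "b \<in> V" "g a \<noteq> g b" for a b
    using d_gates[OF S that(1,2) g g that(3)] that by blast
  have tri: "d a b \<le> d a c + d c b" if "a \<in> V" "b \<in> V" "c \<in> V" for a b c
    using d_triangle that by blast
  \<comment> \<open>Through a common gate \<open>y\<close> would be reached from \<open>x\<close> in
    at most \<open>d x y - 1\<close> steps.\<close>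
  have neq: "g x \<noteq> g y"
  proof
    assume eq: "g x = g y"
    have "d x (g x) \<le> k" using dS[of x p] pq pqS xy by simp
    moreover have "d (g y) y \<le> d x y - Suc k"
      using dS[of y q] pq pqS xy d_commute[of y] by simp
    ultimately show False using tri[OF xy gS(2)[OF xy(1)]] eq \<open>k < d x y\<close> by simp
  qed
  have a: "d x (g x) \<le> k" using dS[of x p] pq pqS xy by simp
  have b: "d (g y) y \<le> d x y - Suc k"
    using dS[of y q] pq pqS xy d_commute[of y] by simp
  have D: "d x y = d x (g x) + d (g x) (g y) + d (g y) y" using dd neq xy by blast
  have \<delta>: "d (g x) (g y) \<le> 2" using d2 gS xy by blast
  have \<delta>1: "d (g x) (g y) \<ge> 1" using neq d_eq_0 gS xy by (metis less_one linorder_not_le)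
  have k: "2 * k \<le> d x y" "d x y \<le> 2 * k + 1" unfolding k_def by simp_all
  \<comment> \<open>The other two summands of \<open>D\<close> total at most
    \<open>d x y - k + 1\<close>, which leaves at least \<open>k - 1\<close>, and \<open>k\<close>
    is at least 2.\<close>
  have a0: "d x (g x) > 0" using D \<delta> b k diam(2) by linarith
  show ?thesis
  proof (cases "d (g y) y = 0")
    case True
    \<comment> \<open>Here \<open>d x y\<close> is at most \<open>k + 2\<close>; since it is also at
      least 4, all bounds are tight.\<close>
    then have ab: "d x (g x) = 2" "d (g x) (g y) = 2" "d x y = 4"
      using D \<delta> a k diam(2) by linarith+
    let ?c = "g x"
    \<comment> \<open>A vertex with gate \<open>?c\<close> has its distance to \<open>y\<close>
      measured through \<open>?c\<close>, any other vertex its distance to \<open>x\<close>. Both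
      ends are at distance 2 from \<open>?c\<close> and the diameter is 4, so every vertex lies
      within 2 of \<open>?c\<close>.\<close>
    have split: "d v x = d v ?c + 2 \<or> d v y = d v ?c + 2" if v: "v \<in> V" for v
    proof (cases "g v = ?c")
      case True
      then show ?thesis using dd[of v y] v xy neq ab \<open>d (g y) y = 0\<close> by simp
    next
      case False
      then show ?thesis using dd[of v x] dS[of v "?c"] v xy gS ab d_commute[of "?c" x] by simp
    qed
    have le2: "d v ?c \<le> 2" if "v \<in> V" for v
      using split[OF that] diam(1)[OF that xy(1)] diam(1)[OF that xy(2)] ab by linarith
    show ?thesis
      using split[OF uw(1)] le2[OF uw(2)] tri[OF uw gS(2)[OF xy(1)]] d_commute[of w ?c] by auto
  next
    case False
    then have out: "x \<notin> S" "y \<notin> S" using a0 g_self by fastforce+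
    let ?C = "{v \<in> S. \<not> connected_on E (V - {v})}"
    have "finite ?C" using S finite_V by (auto simp: block_on_def intro: finite_subset)
    have isC: "g v \<in> ?C" if v: "v \<in> V" "v \<notin> S" for v
    proof -
      obtain s where "s \<in> S" "s \<noteq> g v" using gS[OF xy(1)] gS[OF xy(2)] neq by metis
      then show ?thesis using gate_is_cut[OF S v g] gS v by blast
    qed
    \<comment> \<open>The gates of \<open>x\<close> and \<open>y\<close> already exhaust the two
      cut-vertices allowed in \<open>S\<close>; a third gate would be another one.\<close>
    have gates: "g v = g x \<or> g v = g y" if "v \<in> V" "v \<notin> S" for v
    proof (rule ccontr)
      assume "\<not> ?thesis"
      then have "card {g v, g x, g y} = 3" using neq by auto
      moreover have "card {g v, g x, g y} \<le> card ?C"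
        using isC that xy out by (intro card_mono[OF \<open>finite ?C\<close>]) blast
      ultimately show False using cut by linarith
    qed
    \<comment> \<open>A vertex behind \<open>g x\<close> farther from that gate than
      \<open>x\<close> would be farther from \<open>y\<close> than the diameter.\<close>
    have near_x: "d v (g x) \<le> d x (g x) \<and> d v y = d v (g x) + d (g x) (g y) + d (g y) y"
      if v: "v \<in> V" "g v = g x" for v
      using dd[of v y] diam(1)[of v y] v xy neq D by simp
    have near_y: "d v (g y) \<le> d (g y) y \<and> d v x = d v (g y) + d (g x) (g y) + d x (g x)"
      if v: "v \<in> V" "g v = g y" for v
      using dd[of v x] diam(1)[of v x] v xy neq D d_commute[of "g x"] d_commute[of y x] by simp
    have comm: "d (g x) w = d w (g x)" "d (g y) w = d w (g y)" "d (g y) (g x) = d (g x) (g y)"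
      using d_commute by auto
    \<comment> \<open>For \<open>u\<close> behind \<open>g x\<close> the end point \<open>y\<close>
      is at least as far as \<open>w\<close>; for \<open>u\<close> behind \<open>g y\<close> it is
      \<open>x\<close>. If \<open>w\<close> is behind the same gate, this uses that the edge is in
      the middle: neither arm is longer than the rest of the geodesic.\<close>
    consider (x) "g u = g x" | (y) "g u = g y" | (S) "u \<in> S" "g u = u" "u \<noteq> g x" "u \<noteq> g y"
      using gates[OF uw(1)] g_self by metis
    then show ?thesis
    proof cases
      case x
      consider (x) "g w = g x" | (y) "g w = g y" | (S) "w \<in> S"
        using gates[OF uw(2)] by blast
      then show ?thesis
      proof cases
        case x': x
        then show ?thesis
          using near_x[OF uw(1) x] near_x[OF uw(2) x'] tri[OF uw gS(2)[OF xy(1)]] comm D a b k by auto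
      next
        case y
        then show ?thesis
          using near_x[OF uw(1) x] near_y[OF uw(2) y] dd[OF uw] x neq comm by auto
      next
        case S
        then show ?thesis
          using near_x[OF uw(1) x] dS[OF uw(1) S] d2[OF gS(1)[OF xy(1)] S] x \<delta>1 False by auto
      qed
    next
      case y
      consider (x) "g w = g x" | (y) "g w = g y" | (S) "w \<in> S"
        using gates[OF uw(2)] by blast
      then show ?thesis
      proof cases
        case y': y
        then show ?thesis
          using near_y[OF uw(1) y] near_y[OF uw(2) y'] tri[OF uw gS(2)[OF xy(2)]] comm D a b k by auto
      next
        case x
        then show ?thesis
          using near_y[OF uw(1) y] near_x[OF uw(2) x] dd[OF uw] y neq comm by auto
      next
        case S
        then show ?thesis
          using near_y[OF uw(1) y] dS[OF uw(1) S] d2[OF gS(1)[OF xy(2)] S] y \<delta>1 a0 by auto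
      qed
    next
      case S
      have ux: "d u x = d u (g x) + d x (g x)"
        using dd[of u x] S uw xy d_commute[of "g x" x] by simp
      have uy: "d u y = d u (g y) + d (g y) y"
        using dd[of u y] S uw xy by simp
      have "d u (g x) > 0" using S(3) d_eq_0[of u "g x"] uw gS xy by simp
      consider (x) "g w = g x" | (y) "g w = g y" | (S) "w \<in> S"
        using gates[OF uw(2)] by blast
      then show ?thesis
      proof cases
        case x
        then show ?thesis
          using near_x[OF uw(2) x] tri[OF uw gS(2)[OF xy(1)]] ux comm by auto
      next
        case y
        then show ?thesis
          using near_y[OF uw(2) y] tri[OF uw gS(2)[OF xy(2)]] uy comm by auto
      next
        case S': S
        then show ?thesis using d2[OF S(1) S'] ux \<open>d u (g x) > 0\<close> a0 by auto
      qed
    qed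
  qed
qed

end

section \<open>Graphs and their adjacency relations\<close>

lemma (in wf_digraph) awalk_imp_relpow: "awalk u p v \<Longrightarrow> (u, v) \<in> arcs_ends G ^^ length p"
proof (induction p arbitrary: u)
  case (Cons a p)
  then have "a \<in> arcs G" "u = tail G a" "awalk (head G a) p v" by (auto simp: awalk_Cons_iff)
  then show ?case using Cons.IH relpow_Suc_I2[of u "head G a"] by (auto simp: arcs_ends_conv)
qed (auto simp: awalk_Nil_iff)

lemma (in wf_digraph) relpow_imp_awalk:
  "(u, v) \<in> arcs_ends G ^^ n \<Longrightarrow> u \<in> verts G \<Longrightarrow> \<exists>p. awalk u p v \<and> length p = n"
proof (induction n arbitrary: u)
  case (Suc n)
  from relpow_Suc_D2[OF Suc.prems(1)] obtain w
    where w: "(u, w) \<in> arcs_ends G" "(w, v) \<in> arcs_ends G ^^ n" by auto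
  then obtain p where p: "awalk w p v" "length p = n" using Suc.IH adj_in_verts by blast
  from w(1) obtain a where "a \<in> arcs G" "tail G a = u" "head G a = w" by auto
  with p have "awalk u (a # p) v" by (auto simp: awalk_Cons_iff)
  with p show ?case by (intro exI[of _ "a # p"]) simp
qed (auto simp: awalk_Nil_iff)

text \<open>On \<open>nat\<close>, \<open>Inf\<close> is a \<open>LEAST\<close>, so the two agree
  for unreachable \<open>v\<close> as well.\<close>

lemma (in wf_digraph) gdist_eq_rel_dist:
  "u \<in> verts G \<Longrightarrow> gdist G u v = rel_dist (arcs_ends G) u v"
  unfolding gdist_def rel_dist_def Inf_nat_def
  by (rule arg_cong[where f = Least], rule ext) (auto dest: awalk_imp_relpow relpow_imp_awalk)

lemma (in wf_digraph) reachable_iff_Restr: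
  assumes "u \<in> verts G"
  shows "u \<rightarrow>\<^sup>* v \<longleftrightarrow> (u, v) \<in> (Restr (arcs_ends G) (verts G))\<^sup>*"
proof -
  have "Restr (arcs_ends G) (verts G) = arcs_ends G" using adj_in_verts by auto
  then show ?thesis using reachable_conv'[OF assms] by simp
qed

lemma (in sym_digraph) connected_iff_connected_on:
  "Digraph_Component.connected G \<longleftrightarrow> verts G \<noteq> {} \<and> connected_on (arcs_ends G) (verts G)"
proof -
  have "u \<rightarrow>\<^sup>*\<^bsub>mk_symmetric G\<^esub> v \<longleftrightarrow> (u, v) \<in> (Restr (arcs_ends G) (verts G))\<^sup>*"
    if "u \<in> verts G" for u v
    unfolding reachable_mk_symmetric_eq[OF sym_arcs] using that by (rule reachable_iff_Restr)
  then show ?thesis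
    unfolding connected_def strongly_connected_def connected_on_def by auto
qed

lemma (in sym_digraph) sym_digraph_del_vert: "sym_digraph (del_vert v)"
proof -
  have "symmetric (del_vert v)"
    using sym_arcs unfolding symmetric_conv by (fastforce simp: del_vert_simps)
  then show ?thesis by (rule wf_digraph.sym_digraphI[OF wf_digraph_del_vert])
qed

text \<open>\<open>connected_on\<close> holds for the empty set, which matches the nonemptiness
  conjunct in \<open>cut_vertex\<close> when the only vertex is deleted.\<close>

lemma (in sym_digraph) cut_vertex_iff:
  "cut_vertex G v \<longleftrightarrow> v \<in> verts G \<and> \<not> connected_on (arcs_ends G) (verts G - {v})"
proof -
  interpret D: sym_digraph "del_vert v" by (rule sym_digraph_del_vert)
  have "arcs_ends (del_vert v) = Restr (arcs_ends G) (verts G - {v})"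
    by (auto simp: arcs_ends_conv del_vert_simps)
  then show ?thesis
    unfolding cut_vertex_def D.connected_iff_connected_on
    by (auto simp: connected_on_def del_vert_simps)
qed

lemma (in sym_digraph) biconnected_iff:
  "Digraph_Component.connected G \<and> (\<forall>v. \<not> cut_vertex G v) \<longleftrightarrow>
     verts G \<noteq> {} \<and> biconnected_on (arcs_ends G) (verts G)"
proof -
  have "t \<notin> verts G \<Longrightarrow> verts G - {t} = verts G" for t by simp
  then show ?thesis
    unfolding connected_iff_connected_on cut_vertex_iff biconnected_on_def by fastforce
qed

section \<open>Blocks as maximal biconnected vertex sets\<close>

context graph
begin

lemma arcs_ends_induce: "arcs_ends (G \<restriction> S) = Restr (arcs_ends G) S"
  by (auto simp: arcs_ends_conv)

lemma graph_induce:
  assumes "S \<subseteq> verts G"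
  shows "graph (G \<restriction> S)"
proof -
  have sub: "subgraph (G \<restriction> S) G" using assms by (rule subgraph_induce_subgraphI)
  have "symmetric (G \<restriction> S)"
    using sym_arcs by (auto simp: symmetric_def arcs_ends_induce sym_def)
  then show ?thesis using digraph.graphI[OF digraph_subgraph[OF sub]] by blast
qed

lemma connected_on_Restr: "T \<subseteq> S \<Longrightarrow> connected_on (Restr E S) T \<longleftrightarrow> connected_on E T"
proof -
  assume "T \<subseteq> S"
  then have "Restr (Restr E S) T = Restr E T" by auto
  then show ?thesis by (simp add: connected_on_def)
qed

lemma biconnected_on_Restr: "biconnected_on (Restr E S) S \<longleftrightarrow> biconnected_on E S"
  unfolding biconnected_on_def
  by (simp only: connected_on_Restr[OF order_refl] connected_on_Restr[OF Diff_subset])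

text \<open>The vertex set of a larger connected subgraph \<open>H\<close> without cut-vertices is
  biconnected in \<open>G\<close>, as extra edges preserve this. Maximality gives
  \<open>verts H = S\<close>, and an induced subgraph already has all arcs within
  \<open>S\<close>.\<close>

lemma is_block_induce:
  assumes S: "block_on (verts G) (arcs_ends G) S" "S \<noteq> {}"
  shows "is_block G (G \<restriction> S)"
  unfolding is_block_def
proof (rule max_subgraphI)
  have SV: "S \<subseteq> verts G" using S by (simp add: block_on_def)
  interpret B: graph "G \<restriction> S" by (rule graph_induce[OF SV])
  show "graph (G \<restriction> S) \<and> Digraph_Component.connected (G \<restriction> S) \<and> (\<forall>v. \<not> cut_vertex (G \<restriction> S) v)"
    unfolding B.biconnected_iff using B.graph_axioms S
    by (simp add: arcs_ends_induce biconnected_on_Restr block_on_def)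
  show "subgraph (G \<restriction> S) G" using SV by (rule subgraph_induce_subgraphI)
next
  fix H assume H: "G \<restriction> S \<noteq> H" "subgraph (G \<restriction> S) H" "subgraph H G"
  show "\<not> (graph H \<and> Digraph_Component.connected H \<and> (\<forall>v. \<not> cut_vertex H v))"
  proof
    assume A: "graph H \<and> Digraph_Component.connected H \<and> (\<forall>v. \<not> cut_vertex H v)"
    then interpret H: graph H by simp
    have "biconnected_on (arcs_ends H) (verts H)" using A H.biconnected_iff by blast
    then have "biconnected_on (arcs_ends G) (verts H)"
      using connected_on_mono[OF _ arcs_ends_mono[OF H(3)]] by (auto simp: biconnected_on_def)
    moreover have "S \<subseteq> verts H" "verts H \<subseteq> verts G"
      using H(2,3) by (simp_all add: subgraph_def)
    ultimately have V: "verts H = S" using S by (auto simp: block_on_def)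
    have "arcs H = arcs (G \<restriction> S)"
    proof
      show "arcs H \<subseteq> arcs (G \<restriction> S)"
        using H(3) V H.wellformed
        by (auto simp: subgraph_def compatible_def)
      show "arcs (G \<restriction> S) \<subseteq> arcs H" using H(2) by (simp add: subgraph_def)
    qed
    with V H have "G \<restriction> S = H"
      by (intro pre_digraph.equality) (auto simp: subgraph_def compatible_def)
    with H(1) show False by contradiction
  qed
qed

lemma edge_in_block:
  assumes "(p, q) \<in> arcs_ends G"
  obtains S where "block_on (verts G) (arcs_ends G) S" "p \<in> S" "q \<in> S"
proof -
  let ?P = "\<lambda>S. S \<subseteq> verts G \<and> biconnected_on (arcs_ends G) S \<and> p \<in> S \<and> q \<in> S"
  have qp: "(q, p) \<in> arcs_ends G" using assms by (rule graph_symmetric)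
  have "?P {p, q}"
  proof (intro conjI)
    show "{p, q} \<subseteq> verts G" using assms adj_in_verts by auto
    show "biconnected_on (arcs_ends G) {p, q}"
      unfolding biconnected_on_def
    proof (intro conjI allI)
      show "connected_on (arcs_ends G) {p, q}"
        using assms qp by (auto simp: connected_on_def intro!: r_into_rtrancl)
      then show "connected_on (arcs_ends G) ({p, q} - {t})" for t
        by (cases "t = p"; cases "t = q") (auto simp: connected_on_def insert_Diff_if)
    qed
  qed auto
  moreover have "finite (Collect ?P)" by (rule finite_subset[of _ "Pow (verts G)"]) auto
  ultimately have "\<exists>S\<in>Collect ?P. \<forall>T\<in>Collect ?P. S \<subseteq> T \<longrightarrow> S = T"
    by (intro finite_has_maximal) auto
  then obtain S where S: "?P S" and max: "\<And>T. ?P T \<Longrightarrow> S \<subseteq> T \<Longrightarrow> S = T" by auto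
  have "block_on (verts G) (arcs_ends G) S"
    unfolding block_on_def
  proof (intro conjI allI impI)
    \<comment> \<open>Supersets of \<open>S\<close> contain \<open>p\<close> and \<open>q\<close>,
      so maximality within \<open>?P\<close> is maximality among all biconnected sets.\<close>
    show "T = S" if "S \<subseteq> T \<and> T \<subseteq> verts G \<and> biconnected_on (arcs_ends G) T" for T
      using that S by (intro max[symmetric]) auto
  qed (use S in simp_all)
  with S that show thesis by blast
qed

end

text \<open>Vertices on one side have a common neighbour on the other, nonempty side.
  \<open>E\<close> may exceed the arcs of \<open>B\<close>, as the bound is applied to distances in
  the whole graph.\<close>

lemma complete_bipartite_rel_dist_le_2:
  assumes "complete_bipartite_digraph m n B" "m > 0" "n > 0"
    and "a \<in> verts B" "b \<in> verts B" and "arcs_ends B \<subseteq> E"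
  shows "rel_dist E a b \<le> 2"
proof -
  obtain U W where UW: "verts B = U \<union> W" "card U = m" "card W = n"
    "arcs_ends B = U \<times> W \<union> W \<times> U"
    using assms(1) by (auto simp: complete_bipartite_digraph_def)
  then obtain u w where uw: "u \<in> U" "w \<in> W" using assms(2,3) by (metis card_gt_0_iff ex_in_conv)
  have edge: "rel_dist E a b \<le> 2" if "(a, b) \<in> E"
    using rel_dist_le[of a b 1 E] that by simp
  have two: "rel_dist E a b \<le> 2" if "(a, c) \<in> E" "(c, b) \<in> E" for c
    using rel_dist_le[of a b 2 E] that by (auto simp: numeral_2_eq_2)
  have sub: "U \<times> W \<union> W \<times> U \<subseteq> E" using assms(6) UW by simp
  then consider "(a, b) \<in> E" | "(a, u) \<in> E" "(u, b) \<in> E" | "(a, w) \<in> E" "(w, b) \<in> E"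
    using assms(4,5) UW(1) uw by blast
  then show ?thesis using edge two by cases blast+
qed

lemma (in graph) connected_relation_arcs_ends:
  assumes "Digraph_Component.connected G"
  shows "connected_relation (verts G) (arcs_ends G)"
proof
  show "finite (verts G)" by simp
  show "arcs_ends G \<subseteq> verts G \<times> verts G" using adj_in_verts by auto
  show "sym (arcs_ends G)" using sym_arcs by (simp add: symmetric_def)
  fix u v assume "u \<in> verts G" "v \<in> verts G"
  then show "(u, v) \<in> (arcs_ends G)\<^sup>*"
    using assms unfolding connected_iff_connected_on connected_on_def
    by (meson Int_lower1 rtrancl_mono subsetD)
qed

lemma bi_block_class_farthest:
  assumes G: "G \<in> \<B>"
    and xy: "x \<in> verts G" "y \<in> verts G" "4 \<le> gdist G x y"
    and diam: "\<And>u v. u \<in> verts G \<Longrightarrow> v \<in> verts G \<Longrightarrow> gdist G u v \<le> gdist G x y"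
    and uw: "u \<in> verts G" "w \<in> verts G"
  shows "gdist G u w \<le> max (gdist G u x) (gdist G u y)"
proof -
  from G have gr: "graph G" and co: "Digraph_Component.connected G"
    and bip: "\<And>B. is_block G B \<Longrightarrow> \<exists>m>0. \<exists>n>0. complete_bipartite_digraph m n B"
    and cut: "\<And>B. is_block G B \<Longrightarrow> card {v \<in> verts B. cut_vertex G v} \<le> 2"
    by (auto simp: bi_block_class_def bi_block_graph_def)
  interpret graph G by (rule gr)
  interpret R: connected_relation "verts G" "arcs_ends G"
    using co by (rule connected_relation_arcs_ends)
  have "\<exists>S. block_on (verts G) (arcs_ends G) S \<and> p \<in> S \<and> q \<in> S \<and>
        (\<forall>a\<in>S. \<forall>b\<in>S. R.d a b \<le> 2) \<and>
        card {v \<in> S. \<not> connected_on (arcs_ends G) (verts G - {v})} \<le> 2"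
    if pq: "(p, q) \<in> arcs_ends G" for p q
  proof -
    obtain S where S: "block_on (verts G) (arcs_ends G) S" "p \<in> S" "q \<in> S"
      using edge_in_block pq by blast
    then have B: "is_block G (G \<restriction> S)" by (intro is_block_induce) auto
    have "R.d a b \<le> 2" if ab: "a \<in> S" "b \<in> S" for a b
    proof -
      obtain m n where "m > 0" "n > 0" "complete_bipartite_digraph m n (G \<restriction> S)"
        using bip[OF B] by blast
      then show ?thesis
        using complete_bipartite_rel_dist_le_2[of m n "G \<restriction> S"] ab by (auto simp: arcs_ends_induce)
    qed
    moreover have "{v \<in> S. \<not> connected_on (arcs_ends G) (verts G - {v})} =
        {v \<in> verts (G \<restriction> S). cut_vertex G v}"
      using S by (auto simp: cut_vertex_iff block_on_def)
    then have "card {v \<in> S. \<not> connected_on (arcs_ends G) (verts G - {v})} \<le> 2"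
      using cut[OF B] by simp
    ultimately show ?thesis using S by (intro exI[of _ S]) simp
  qed
  then show ?thesis
    using R.farthest_from_diametral_pair[of x y u w] xy diam uw
    by (simp only: gdist_eq_rel_dist)
qed

section \<open>Eccentricity and diameter as attained maxima\<close>

lemma eccentricity_ge: "finite (verts G) \<Longrightarrow> v \<in> verts G \<Longrightarrow> gdist G u v \<le> eccentricity G u"
  unfolding eccentricity_def by (rule Max_ge) simp_all

lemma eccentricity_attained:
  assumes "finite (verts G)" "verts G \<noteq> {}"
  obtains v where "v \<in> verts G" "gdist G u v = eccentricity G u"
proof -
  have "eccentricity G u \<in> gdist G u ` verts G"
    unfolding eccentricity_def using assms by (intro Max_in) auto
  with that show thesis by auto
qed

lemma diam_attained:
  assumes "finite (verts G)" "verts G \<noteq> {}"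
  obtains x y where "x \<in> verts G" "y \<in> verts G" "gdist G x y = diam G"
proof -
  have "diam G \<in> eccentricity G ` verts G"
    unfolding diam_def using assms by (intro Max_in) auto
  then obtain x where "x \<in> verts G" "eccentricity G x = diam G" by auto
  with that eccentricity_attained[OF assms, of x] show thesis by metis
qed

lemma gdist_le_diam:
  assumes "finite (verts G)" "u \<in> verts G" "v \<in> verts G"
  shows "gdist G u v \<le> diam G"
proof -
  have "eccentricity G u \<le> diam G" unfolding diam_def using assms by (intro Max_ge) auto
  then show ?thesis using eccentricity_ge[OF assms(1,3), of u] by simp
qed

section \<open>Irreducibility\<close>

lemma mult_permutation_mat_index:
  fixes M :: "'a :: semiring_1 mat"
  assumes p: "p permutes {..<n}" and P: "P = mat n n (\<lambda>(i, j). if j = p i then 1 else 0)"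
    and M: "M \<in> carrier_mat n n" and ij: "i < n" "j < n"
  shows "(P * M * P\<^sup>T) $$ (i, j) = M $$ (p i, p j)"
proof -
  have pi: "p i < n" "p j < n" using permutes_in_image[OF p] ij by auto
  have PM: "(P * M) $$ (i, k) = M $$ (p i, k)" if "k < n" for k
  proof -
    have "(P * M) $$ (i, k) = (\<Sum>l = 0..<n. (if l = p i then 1 else 0) * M $$ (l, k))"
      using P M ij that by (simp add: scalar_prod_def)
    also have "\<dots> = (\<Sum>l = 0..<n. if l = p i then M $$ (l, k) else 0)"
      by (intro sum.cong) auto
    finally show ?thesis using pi by simp
  qed
  have "(P * M * P\<^sup>T) $$ (i, j) = (\<Sum>l = 0..<n. (P * M) $$ (i, l) * (if l = p j then 1 else 0))"
    using P M ij by (simp add: scalar_prod_def)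
  also have "\<dots> = (\<Sum>l = 0..<n. if l = p j then (P * M) $$ (i, l) else 0)"
    by (intro sum.cong) auto
  finally show ?thesis using pi PM by simp
qed

text \<open>It suffices to look at the boundary after the first diagonal block: with
  \<open>A\<close> the original indices of that block, the zero region below it contradicts the
  entry supplied by \<open>split\<close>.\<close>

lemma irreducible_matI:
  fixes M :: "'a :: semiring_1 mat"
  assumes M: "M \<in> carrier_mat n n"
    and split: "\<And>A. A \<subseteq> {..<n} \<Longrightarrow> A \<noteq> {} \<Longrightarrow> A \<noteq> {..<n} \<Longrightarrow>
      \<exists>i\<in>{..<n} - A. \<exists>j\<in>A. M $$ (i, j) \<noteq> 0"
  shows "irreducible_mat M"
  unfolding irreducible_mat_def
proof (intro conjI notI)
  show "square_mat M" using M by auto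
next
  assume "\<exists>P ns. permutation_mat (dim_row M) P \<and> 2 \<le> length ns \<and> (\<forall>n\<in>set ns. 0 < n) \<and>
    block_upper_triangular ns (P * M * P\<^sup>T)"
  then obtain P ns where P: "permutation_mat n P" and ns: "2 \<le> length ns" "\<forall>n\<in>set ns. 0 < n"
    and tri: "block_upper_triangular ns (P * M * P\<^sup>T)" using M by auto
  from P obtain p where p: "p permutes {..<n}"
    and Pp: "P = mat n n (\<lambda>(i, j). if j = p i then 1 else 0)"
    by (auto simp: permutation_mat_def)
  have "P * M * P\<^sup>T \<in> carrier_mat n n"
    using Pp M by (intro mult_carrier_mat[of _ n n]) auto
  then have n: "sum_list ns = n" using tri by (simp only: block_upper_triangular_def carrier_mat_def) auto
  obtain a b ns' where ns': "ns = a # b # ns'"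
    using ns(1) by (cases ns rule: remdups_adj.cases) auto
  \<comment> \<open>The second block is nonempty, whence \<open>a < n\<close>.\<close>
  have a: "0 < a" "a < n" using ns(2) ns' n by auto
  have zero: "M $$ (p i, p j) = 0" if "a \<le> i" "i < n" "j < a" for i j
  proof -
    have "\<forall>r\<le>length ns. \<forall>i<n. \<forall>j<n. j < sum_list (take r ns) \<and> sum_list (take r ns) \<le> i \<longrightarrow>
        (P * M * P\<^sup>T) $$ (i, j) = 0"
      using tri unfolding block_upper_triangular_def n by blast
    then have "1 \<le> length ns \<longrightarrow> (\<forall>i<n. \<forall>j<n. j < sum_list (take 1 ns) \<and>
        sum_list (take 1 ns) \<le> i \<longrightarrow> (P * M * P\<^sup>T) $$ (i, j) = 0)" by (rule spec)
    then have "\<forall>i<n. \<forall>j<n. j < a \<and> a \<le> i \<longrightarrow> (P * M * P\<^sup>T) $$ (i, j) = 0"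
      using ns' by simp
    then have "(P * M * P\<^sup>T) $$ (i, j) = 0" using that a by auto
    then show ?thesis using mult_permutation_mat_index[OF p Pp M, of i j] that a by simp
  qed
  let ?A = "p ` {..<a}"
  have "?A \<subseteq> {..<n}" using permutes_image[OF p] a by auto
  moreover have "?A \<noteq> {}" using a by auto
  moreover have "card ?A \<le> a" using card_image_le[of "{..<a}" p] by simp
  then have "?A \<noteq> {..<n}" using a by fastforce
  ultimately have "\<exists>i\<in>{..<n} - ?A. \<exists>j\<in>?A. M $$ (i, j) \<noteq> 0" by (rule split)
  then obtain i j where ij: "i \<in> {..<n}" "i \<notin> ?A" "j < a" "M $$ (i, p j) \<noteq> 0" by auto
  then have "i \<in> p ` {..<n}" using permutes_image[OF p] by simp
  then obtain i' where "i' < n" "i = p i'" by auto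
  with ij have "a \<le> i'" by (metis image_eqI lessThan_iff linorder_not_le)
  with ij zero \<open>i' < n\<close> \<open>i = p i'\<close> show False by simp
qed

theorem theorem4p10:
  fixes G :: "('a, 'b) pre_digraph" and vs :: "'a list"
  assumes "G \<in> \<B>"
    and "diam G \<ge> 4"
    and "distinct vs" and "set vs = verts G"
  shows "irreducible_mat (eccentricity_mat G vs)"
proof -
  from assms(1) have gr: "graph G" and co: "Digraph_Component.connected G"
    by (auto simp: bi_block_class_def bi_block_graph_def)
  interpret graph G by (rule gr)
  have ne: "verts G \<noteq> {}" using co connected_iff_connected_on by blast
  have comm: "gdist G u v = gdist G v u" if "u \<in> verts G" "v \<in> verts G" for u v
    using that rel_dist_commute[of "arcs_ends G"] sym_arcs
    by (simp add: gdist_eq_rel_dist symmetric_def)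
  obtain x y where xy: "x \<in> verts G" "y \<in> verts G" "gdist G x y = diam G"
    using diam_attained[OF finite_verts ne] by blast
  have far: "eccentricity G u = max (gdist G u x) (gdist G u y)" if u: "u \<in> verts G" for u
  proof -
    obtain w where "w \<in> verts G" and "gdist G u w = eccentricity G u"
      using eccentricity_attained[OF finite_verts ne] by blast
    moreover have "gdist G u w \<le> max (gdist G u x) (gdist G u y)"
      using assms(1) xy(1,2)
    proof (rule bi_block_class_farthest)
      show "4 \<le> gdist G x y" using xy(3) assms(2) by simp
      show "gdist G a b \<le> gdist G x y" if "a \<in> verts G" "b \<in> verts G" for a b
        unfolding xy(3) using finite_verts that by (rule gdist_le_diam)
    qed fact+
    ultimately show ?thesis
      using eccentricity_ge[OF finite_verts xy(1), of u] eccentricity_ge[OF finite_verts xy(2), of u]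
      by simp
  qed
  define n where "n = length vs"
  have vs: "vs ! i \<in> verts G" if "i < n" for i
    using nth_mem[of i vs] that unfolding n_def assms(4) by simp
  let ?M = "eccentricity_mat G vs"
  \<comment> \<open>The distance never exceeds the eccentricity of the second vertex, so equality
    with that of the first makes it the minimum.\<close>
  have entry: "?M $$ (i, j) \<noteq> 0"
    if "i < n" "j < n" "gdist G (vs ! i) (vs ! j) = eccentricity G (vs ! i)"
      "gdist G (vs ! i) (vs ! j) > 0" for i j
  proof -
    have "vs ! i \<in> verts G" "vs ! j \<in> verts G" using that(1,2) by (simp_all add: vs)
    then have "gdist G (vs ! i) (vs ! j) \<le> eccentricity G (vs ! j)"
      using comm eccentricity_ge[of G "vs ! i" "vs ! j"] by simp
    then show ?thesis using that unfolding n_def eccentricity_mat_def by simp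
  qed
  have sym: "?M $$ (i, j) = ?M $$ (j, i)" if "i < n" "j < n" for i j
    using that comm[OF vs vs, of i j] unfolding n_def eccentricity_mat_def
    by (simp add: min.commute)
  obtain a b where ab: "a < n" "vs ! a = x" "b < n" "vs ! b = y"
    using xy assms(4) unfolding n_def by (metis in_set_conv_nth)
  have M_ab: "?M $$ (a, b) \<noteq> 0"
    using entry[OF ab(1,3)] far[OF xy(1)] ab xy assms(2) gdist_le_diam[of G x x] by simp
  have M_i: "?M $$ (i, a) \<noteq> 0 \<or> ?M $$ (i, b) \<noteq> 0" if "i < n" for i
  proof -
    let ?u = "vs ! i"
    have u: "?u \<in> verts G" using that by (rule vs)
    interpret R: connected_relation "verts G" "arcs_ends G"
      using co by (rule connected_relation_arcs_ends)
    \<comment> \<open>Hence the maximum in \<open>far\<close> is positive, also when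
      \<open>?u\<close> is \<open>x\<close> or \<open>y\<close> itself.\<close>
    have "4 \<le> gdist G ?u x + gdist G ?u y"
      using R.d_triangle[OF xy(1) u xy(2)] R.d_commute[of x ?u] xy assms(2) u
      by (simp add: gdist_eq_rel_dist)
    then show ?thesis
      using far[OF u] entry[OF that ab(1)] entry[OF that ab(3)] ab by (auto simp: max_def split: if_splits)
  qed
  show ?thesis
  proof (rule irreducible_matI[where n = n])
    show "?M \<in> carrier_mat n n" by (simp add: eccentricity_mat_def n_def)
    fix A assume A: "A \<subseteq> {..<n}" "A \<noteq> {}" "A \<noteq> {..<n}"
    then obtain i j where ij: "i \<in> A" "j < n" "j \<notin> A" by blast
    show "\<exists>i\<in>{..<n} - A. \<exists>j\<in>A. ?M $$ (i, j) \<noteq> 0"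
    proof (rule ccontr)
      assume "\<not> ?thesis"
      then have zero: "?M $$ (i, j) = 0" "?M $$ (j, i) = 0" if "i < n" "i \<notin> A" "j \<in> A" for i j
        using that sym[of i j] A(1) by auto
      \<comment> \<open>No nonzero entry crosses between \<open>A\<close> and its complement. The
        linked indices \<open>a\<close> and \<open>b\<close> thus lie on one side, but
        \<open>i\<close> in \<open>A\<close> and \<open>j\<close> outside are each linked to
        \<open>a\<close> or \<open>b\<close>.\<close>
      have "a \<in> A \<longleftrightarrow> b \<in> A" using zero ab M_ab by metis
      then show False using M_i[of i] M_i[of j] zero ij ab A(1) by (metis lessThan_iff subsetD)
    qed
  qed
qed

end
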